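(* Let $f\in\mathcal{C}(SG)$, let $N\ge1$, let $\alpha_\omega\in\mathcal{C}(SG)$ ($\omega\in I^N$) satisfy $\|\alpha_\omega\|_\infty<1$, let $b\in\mathcal{C}(SG)$ satisfy $b(p_j)=f(p_j)$ for $j=1,2,3$, and let $f^\alpha$ be the $\alpha$-fractal function corresponding to $f$. If $\alpha_\omega(t)\ge0$ for all $\omega\in I^N$ and $b(t)\ge f(t)$ for every $t\in SG$, then $f^\alpha(t)\le f(t)$ for all $t\in SG$.
   Context: Let $V_0=\{p_1,p_2,p_3\}$ be the vertices of an equilateral triangle in $\mathbb{R}^2$, $L_i(t)=\frac12(t+p_i)$ for $i\in I=\{1,2,3\}$, and let $SG$ (the Sierpiński gasket) be the unique nonempty compact set with $SG=\bigcup_{i=1}^3L_i(SG)$. For $\omega=\omega_1\cdots\omega_N\in I^N$ put $L_\omega=L_{\omega_1}\circ\cdots\circ L_{\omega_N}$. $\mathcal{C}(SG)$ is the space of continuous real-valued functions on $SG$ with the sup norm $\|\cdot\|_\infty$. Given $f,b$ and $(\alpha_\omega)_{\omega\in I^N}$, the $\alpha$-fractal function $f^\alpha$ is the unique continuous function on $SG$ satisfying, for all $\omega\in I^N$ and $t\in SG$, $$f^\alpha(L_\omega(t))=f(L_\omega(t))+\alpha_\omega(t)\,(f^\alpha-b)(t).$$ *)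

theory Defs
  imports "HOL-Analysis.Analysis"
begin

text \<open>
  The index set \<open>I = {1,2,3}\<close> is the three-element type \<open>3\<close> (whose elements are \<open>1, 2, 3\<close>, with
  \<open>3 = 0\<close>), so \<open>p :: 3 \<Rightarrow> real^2\<close> lists the vertices of the triangle, and words
  over \<open>I\<close> are lists of type \<open>3 list\<close>.
  A real-valued function on the gasket is represented by a total function on the plane
  of which only the values on the gasket matter.
\<close>

definition equilateral_triangle :: "(3 \<Rightarrow> real^2) \<Rightarrow> bool" where
  "equilateral_triangle p \<longleftrightarrow> (\<exists>d>0. \<forall>i j. i \<noteq> j \<longrightarrow> dist (p i) (p j) = d)"

definition sg_map :: "(3 \<Rightarrow> real^2) \<Rightarrow> 3 \<Rightarrow> real^2 \<Rightarrow> real^2" where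
  "sg_map p i t = (1/2) *\<^sub>R (t + p i)"

definition sierpinski_gasket :: "(3 \<Rightarrow> real^2) \<Rightarrow> (real^2) set" where
  "sierpinski_gasket p =
     (THE S. compact S \<and> S \<noteq> {} \<and> S = (\<Union>i. sg_map p i ` S))"

primrec sg_word_map :: "(3 \<Rightarrow> real^2) \<Rightarrow> 3 list \<Rightarrow> real^2 \<Rightarrow> real^2" where
  "sg_word_map p [] = id"
| "sg_word_map p (i # \<omega>) = sg_map p i \<circ> sg_word_map p \<omega>"

definition sg_words :: "nat \<Rightarrow> 3 list set" where
  "sg_words N = {\<omega>. length \<omega> = N}"

definition sup_norm_on :: "'a set \<Rightarrow> ('a \<Rightarrow> real) \<Rightarrow> real" where
  "sup_norm_on S g = (SUP t\<in>S. \<bar>g t\<bar>)"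

text \<open>
  Membership in \<open>extensional\<close> fixes the irrelevant values outside the gasket, so that
  uniqueness as a function on the gasket is uniqueness as a HOL function.
\<close>

definition alpha_fractal ::
  "(3 \<Rightarrow> real^2) \<Rightarrow> nat \<Rightarrow> (3 list \<Rightarrow> real^2 \<Rightarrow> real) \<Rightarrow> (real^2 \<Rightarrow> real) \<Rightarrow> (real^2 \<Rightarrow> real)
    \<Rightarrow> real^2 \<Rightarrow> real" where
  "alpha_fractal p N \<alpha> b f =
     (THE g. g \<in> extensional (sierpinski_gasket p) \<and>
        continuous_on (sierpinski_gasket p) g \<and>
        (\<forall>\<omega>\<in>sg_words N. \<forall>t\<in>sierpinski_gasket p.
           g (sg_word_map p \<omega> t) = f (sg_word_map p \<omega> t) + \<alpha> \<omega> t * (g t - b t)))"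

end

theory Submission
  imports Defs
begin

text \<open>
  Write \<open>K\<close> for the gasket. With \<open>u = f\<^sup>\<alpha> - b\<close> and \<open>q = f - b\<close> the functional equation reads
  \<open>u = q + S u\<close>, where \<open>S\<close> is the linear operator \<open>(S g) (L\<^sub>\<omega> t) = \<alpha>\<^sub>\<omega> t * g t\<close>.

  The inequality is a maximum principle. For \<open>h = f\<^sup>\<alpha> - f\<close> the equation says
  \<open>h (L\<^sub>\<omega> t) = \<alpha>\<^sub>\<omega> t * (h t + q t)\<close>, and since \<open>\<alpha>\<^sub>\<omega> \<ge> 0\<close> and \<open>q \<le> 0\<close> each value of \<open>h\<close> is
  at most a factor in \<open>[0,1)\<close> times another value of \<open>h\<close>. At a maximum this is possible only
  if \<open>h \<le> 0\<close>; this is lemma \<open>contracted_values_nonpos\<close>. The same lemma, applied to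
  other functions, gives uniqueness of the gasket, uniqueness of \<open>f\<^sup>\<alpha>\<close>, and the fact that
  a vertex is the only point of \<open>K\<close> at which a linear functional singling it out is maximal.

  Both the gasket and \<open>f\<^sup>\<alpha>\<close> are definite descriptions, so the argument applies only
  once they are known to exist. The gasket is the closure of the orbit of the vertices under
  all word maps. The function \<open>f\<^sup>\<alpha>\<close> is \<open>b\<close> plus the Neumann series
  \<open>\<Sum>n. S\<^sup>n q\<close>, which converges uniformly because the sup norms of the finitely many \<open>\<alpha>\<^sub>\<omega>\<close>
  have a common bound below 1. That \<open>S\<close> is well defined and preserves continuity is the
  geometric point: distinct cells \<open>L\<^sub>\<omega> K\<close> of the same level meet only at images of vertices
  (lemma \<open>cells_meet_at_vertices\<close>), and there both candidate values vanish, because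
  \<open>q\<close>, and with it each \<open>S\<^sup>n q\<close>, is zero at the vertices.
\<close>

section \<open>A maximum principle\<close>

text \<open>
  Evaluate the hypothesis at a maximum point of \<open>d\<close>: a positive maximum \<open>M\<close> would satisfy
  \<open>M \<le> a * M\<close> with \<open>a < 1\<close>.
\<close>

lemma contracted_values_nonpos:
  fixes d :: "'a::topological_space \<Rightarrow> real"
  assumes "compact K" "continuous_on K d"
    and contr: "\<And>x. x \<in> K \<Longrightarrow> \<exists>y\<in>K. \<exists>a. 0 \<le> a \<and> a < 1 \<and> d x \<le> a * d y"
    and "x \<in> K"
  shows "d x \<le> 0"
proof -
  obtain m where m: "m \<in> K" and max: "\<And>y. y \<in> K \<Longrightarrow> d y \<le> d m"
    using continuous_attains_sup[of K d] assms by auto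
  obtain y a where y: "y \<in> K" "0 \<le> a" "a < 1" "d m \<le> a * d y"
    using contr[OF m] by blast
  have "a * d y \<le> a * d m"
    using y max by (intro mult_left_mono) auto
  with y have "(1 - a) * d m \<le> 0"
    by (simp add: algebra_simps)
  with y have "d m \<le> 0"
    by (simp add: mult_le_0_iff)
  with max[OF \<open>x \<in> K\<close>] show ?thesis by simp
qed

section \<open>The gasket as an attractor\<close>

lemma dist_sg_map: "dist (sg_map p i x) (sg_map p i y) = dist x y / 2"
proof -
  have "sg_map p i x - sg_map p i y = (1/2) *\<^sub>R (x - y)"
    by (simp add: sg_map_def algebra_simps)
  then show ?thesis by (simp add: dist_norm)
qed

lemma sg_map_eq_iff: "sg_map p i x = sg_map p i y \<longleftrightarrow> x = y"
  by (simp add: sg_map_def)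

lemma sg_map_vertex: "sg_map p i (p i) = p i"
  by (simp add: sg_map_def scaleR_2[symmetric])

lemma continuous_on_sg_map: "continuous_on A (sg_map p i)"
  unfolding sg_map_def by (intro continuous_intros)

definition sg_attractor :: "(3 \<Rightarrow> real^2) \<Rightarrow> (real^2) set \<Rightarrow> bool" where
  "sg_attractor p S \<longleftrightarrow> compact S \<and> S \<noteq> {} \<and> S = (\<Union>i. sg_map p i ` S)"

lemma sg_attractor_cases:
  assumes "sg_attractor p S" "x \<in> S"
  obtains i y where "y \<in> S" "x = sg_map p i y"
  using assms unfolding sg_attractor_def by blast

lemma sg_attractor_closed_under_map:
  assumes "sg_attractor p S" "x \<in> S"
  shows "sg_map p i x \<in> S"
  using assms unfolding sg_attractor_def by blast

text \<open>
  The maximum principle applies to the distance to \<open>S'\<close>: every \<open>sg_map p i\<close> at least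
  halves it, since \<open>S'\<close> is invariant.
\<close>

lemma sg_attractor_subset:
  assumes S: "sg_attractor p S" and S': "sg_attractor p S'"
  shows "S \<subseteq> S'"
proof
  fix x assume x: "x \<in> S"
  have comp: "compact S" "compact S'" "S' \<noteq> {}"
    using S S' by (auto simp: sg_attractor_def)
  have "infdist x S' \<le> 0"
  proof (rule contracted_values_nonpos[OF comp(1) _ _ x, where d = "\<lambda>x. infdist x S'"])
    show "continuous_on S (\<lambda>x. infdist x S')"
      by (intro continuous_intros)
  next
    fix v assume "v \<in> S"
    then obtain i y where y: "y \<in> S" "v = sg_map p i y"
      using sg_attractor_cases[OF S] by blast
    obtain z where z: "z \<in> S'" "infdist y S' = dist y z"
      using infdist_attains_inf[of S' y] comp compact_imp_closed by blast
    have "infdist v S' \<le> dist v (sg_map p i z)"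
      by (rule infdist_le) (rule sg_attractor_closed_under_map[OF S' z(1)])
    also have "\<dots> = (1/2) * infdist y S'"
      by (simp add: y z dist_sg_map)
    finally show "\<exists>y\<in>S. \<exists>a. 0 \<le> a \<and> a < 1 \<and> infdist v S' \<le> a * infdist y S'"
      using y(1) by (intro bexI[of _ y] exI[of _ "1/2"]) auto
  qed
  then have "infdist x S' = 0"
    using infdist_nonneg[of x S'] by linarith
  with comp show "x \<in> S'"
    using in_closed_iff_infdist_zero[of S' x] compact_imp_closed by blast
qed

lemma norm_sg_word_map_vertex_le:
  assumes "\<And>i. norm (p i) \<le> R"
  shows "norm (sg_word_map p \<omega> (p j)) \<le> R"
proof (induction \<omega>)
  case Nil
  then show ?case by (simp add: assms)
next
  case (Cons i \<omega>)
  have "norm (sg_word_map p \<omega> (p j) + p i) \<le> R + R"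
    by (rule norm_triangle_mono[OF Cons assms])
  then show ?case by (simp add: sg_map_def)
qed

text \<open>
  The orbit of the vertices is invariant because each vertex is a fixed point of its own map, so
  prepending a letter loses no point of the orbit. Taking closures commutes X
\<close>

lemma sg_attractor_exists: "\<exists>S. sg_attractor p S"
proof -
  define V where "V = {sg_word_map p \<omega> (p j) | \<omega> j. True}"
  have inv: "V = (\<Union>i. sg_map p i ` V)"
  proof (intro equalityI subsetI)
    fix x assume "x \<in> V"
    then obtain \<omega> j where x: "x = sg_word_map p \<omega> (p j)"
      by (auto simp: V_def)
    show "x \<in> (\<Union>i. sg_map p i ` V)"
    proof (cases \<omega>)
      case Nil
      have "p j \<in> V"
        unfolding V_def by (rule CollectI, rule exI[of _ "[]"], rule exI[of _ j]) simp
      moreover have "x = sg_map p j (p j)"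
        by (simp add: x Nil sg_map_vertex)
      ultimately show ?thesis by blast
    next
      case (Cons i \<tau>)
      have "sg_word_map p \<tau> (p j) \<in> V"
        unfolding V_def by blast
      moreover have "x = sg_map p i (sg_word_map p \<tau> (p j))"
        by (simp add: x Cons)
      ultimately show ?thesis by blast
    qed
  next
    fix x assume "x \<in> (\<Union>i. sg_map p i ` V)"
    then obtain i \<omega> j where "x = sg_map p i (sg_word_map p \<omega> (p j))"
      by (auto simp: V_def)
    then have "x = sg_word_map p (i # \<omega>) (p j)" by simp
    then show "x \<in> V" unfolding V_def by blast
  qed
  have "norm (p i) \<le> Max (range (\<lambda>i. norm (p i)))" for i
    by (rule Max_ge) auto
  then have "\<forall>x\<in>V. norm x \<le> Max (range (\<lambda>i. norm (p i)))"
    unfolding V_def using norm_sg_word_map_vertex_le by blast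
  then have "bounded V"
    unfolding bounded_iff by blast
  then have comp: "compact (closure V)"
    by (simp add: compact_closure)
  have "closure V = (\<Union>i. sg_map p i ` closure V)"
  proof (rule equalityI)
    have "compact (\<Union>i. sg_map p i ` closure V)"
      by (intro compact_UN compact_continuous_image continuous_on_sg_map comp finite)
    then have "closed (\<Union>i. sg_map p i ` closure V)"
      by (rule compact_imp_closed)
    moreover have "V \<subseteq> (\<Union>i. sg_map p i ` closure V)"
      using inv closure_subset[of V] by blast
    ultimately show "closure V \<subseteq> (\<Union>i. sg_map p i ` closure V)"
      by (intro closure_minimal)
    have "sg_map p i ` closure V \<subseteq> closure V" for i
      by (rule image_closure_subset[OF continuous_on_sg_map closed_closure])
        (use inv closure_subset[of V] in blast)
    then show "(\<Union>i. sg_map p i ` closure V) \<subseteq> closure V"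
      by blast
  qed
  moreover have "V \<noteq> {}"
    unfolding V_def by blast
  ultimately show ?thesis
    using comp unfolding sg_attractor_def by (intro exI[of _ "closure V"]) auto
qed

lemma sg_attractor_sierpinski_gasket: "sg_attractor p (sierpinski_gasket p)"
proof -
  have "\<exists>!S. sg_attractor p S"
    using sg_attractor_exists sg_attractor_subset by blast
  then have "sg_attractor p (THE S. sg_attractor p S)"
    by (rule theI')
  then show ?thesis
    unfolding sierpinski_gasket_def sg_attractor_def .
qed

lemma compact_sierpinski_gasket: "compact (sierpinski_gasket p)"
  using sg_attractor_sierpinski_gasket sg_attractor_def by blast

section \<open>Cells of the gasket\<close>

text \<open>
  Two uses of the maximum principle. The excess of the functional over its value at \<open>p j\<close>
  contracts under every map, so it is nonpositive on \<open>K\<close>. A point with excess zero must come from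
  another such point under the map with index \<open>j\<close>, which halves the distance to \<open>p j\<close>.
\<close>

lemma strict_max_vertex:
  fixes p :: "3 \<Rightarrow> real^2" and v :: "real^2"
  defines "K \<equiv> sierpinski_gasket p"
  assumes strict: "\<And>k. k \<noteq> j \<Longrightarrow> inner v (p k) < inner v (p j)"
    and x: "x \<in> K"
  shows "inner v x \<le> inner v (p j)"
    and "inner v x = inner v (p j) \<Longrightarrow> x = p j"
proof -
  have K: "sg_attractor p K" "compact K"
    unfolding K_def by (rule sg_attractor_sierpinski_gasket compact_sierpinski_gasket)+
  have half: "inner v (sg_map p k y) = (inner v y + inner v (p k)) / 2" for k y
    by (simp add: sg_map_def inner_add_right)
  have vertices: "inner v (p k) \<le> inner v (p j)" for k
    using strict[of k] by (cases "k = j") auto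
  have le: "inner v z \<le> inner v (p j)" if "z \<in> K" for z
  proof -
    have "inner v z - inner v (p j) \<le> 0"
    proof (rule contracted_values_nonpos[OF K(2) _ _ that, where d = "\<lambda>z. inner v z - inner v (p j)"])
      show "continuous_on K (\<lambda>z. inner v z - inner v (p j))"
        by (intro continuous_intros)
    next
      fix w assume "w \<in> K"
      then obtain k y where y: "y \<in> K" "w = sg_map p k y"
        using sg_attractor_cases[OF K(1)] by blast
      have "inner v w - inner v (p j) \<le> (1/2) * (inner v y - inner v (p j))"
        using vertices[of k] by (simp add: y half field_simps)
      then show "\<exists>y\<in>K. \<exists>a. 0 \<le> a \<and> a < 1 \<and>
          inner v w - inner v (p j) \<le> a * (inner v y - inner v (p j))"
        using y(1) by (intro bexI[of _ y] exI[of _ "1/2"]) auto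
    qed
    then show ?thesis by simp
  qed
  show "inner v x \<le> inner v (p j)"
    by (rule le[OF x])
  assume eq: "inner v x = inner v (p j)"
  define F where "F = K \<inter> {z. inner v z = inner v (p j)}"
  have compF: "compact F"
    unfolding F_def by (intro compact_Int_closed K(2) closed_hyperplane)
  have "x \<in> F"
    using x eq by (simp add: F_def)
  have "dist x (p j) \<le> 0"
  proof (rule contracted_values_nonpos[OF compF _ _ \<open>x \<in> F\<close>, where d = "\<lambda>z. dist z (p j)"])
    show "continuous_on F (\<lambda>z. dist z (p j))"
      by (intro continuous_intros)
  next
    fix w assume w: "w \<in> F"
    then have "w \<in> K" by (simp add: F_def)
    then obtain k y where y: "y \<in> K" "w = sg_map p k y"
      using sg_attractor_cases[OF K(1)] by blast
    have sum: "inner v y + inner v (p k) = 2 * inner v (p j)"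
      using w by (simp add: F_def y half)
    then have "\<not> inner v (p k) < inner v (p j)"
      using le[OF y(1)] by linarith
    then have k: "k = j" using strict by blast
    with sum have "y \<in> F" using y by (simp add: F_def)
    moreover have "dist w (p j) = (1/2) * dist y (p j)"
      using dist_sg_map[of p j y "p j"] by (simp add: y k sg_map_vertex)
    ultimately show "\<exists>y\<in>F. \<exists>a. 0 \<le> a \<and> a < 1 \<and> dist w (p j) \<le> a * dist y (p j)"
      by (intro bexI[of _ y] exI[of _ "1/2"]) auto
  qed
  then show "x = p j" by simp
qed

text \<open>
  An edge direction of an equilateral triangle singles out the end point of the edge: the third
  vertex projects to the midpoint of that edge.
\<close>

lemma edge_functional_strict_max:
  assumes "equilateral_triangle p" "i \<noteq> j" "k \<noteq> j"
  shows "inner (p j - p i) (p k) < inner (p j - p i) (p j)"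
proof -
  obtain d where d: "d > 0" "\<And>i j. i \<noteq> j \<Longrightarrow> dist (p i) (p j) = d"
    using assms(1) by (auto simp: equilateral_triangle_def)
  have ij: "inner (p j - p i) (p j - p i) = d\<^sup>2" and kj: "inner (p k - p j) (p k - p j) = d\<^sup>2"
    using d(2)[of j i] d(2)[of k j] assms
    by (auto simp: dist_norm power2_norm_eq_inner[symmetric])
  have ki: "inner (p k - p i) (p k - p i) \<le> d\<^sup>2"
    using d(2)[of k i] by (cases "k = i") (auto simp: dist_norm power2_norm_eq_inner[symmetric])
  have "inner (p k - p i) (p k - p i) = inner (p k - p j) (p k - p j)
      + inner (p j - p i) (p j - p i) + 2 * (inner (p j - p i) (p k) - inner (p j - p i) (p j))"
    by (simp add: inner_diff_left inner_diff_right inner_commute)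
  moreover have "d\<^sup>2 > 0" using d(1) by simp
  ultimately show ?thesis
    using ij kj ki by argo
qed

lemma other_index: "\<exists>i::3. i \<noteq> j"
proof -
  have "(1::3) \<noteq> 2" by simp
  then show ?thesis by metis
qed

text \<open>
  Vertices are extreme: \<open>p j\<close> is the midpoint of \<open>s\<close> and \<open>p k\<close>, and a functional that is maximal on
  the gasket only at \<open>p j\<close> must then be maximal at \<open>s\<close> too.
\<close>

lemma sg_map_eq_vertex:
  assumes "equilateral_triangle p" "s \<in> sierpinski_gasket p" "sg_map p k s = p j"
  shows "s = p j"
proof -
  obtain i where i: "i \<noteq> j" using other_index by blast
  let ?v = "p j - p i"
  note strict = edge_functional_strict_max[OF assms(1) i]
  have "inner ?v (p j) = (inner ?v s + inner ?v (p k)) / 2"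
    unfolding assms(3)[symmetric] by (simp add: sg_map_def inner_add_right)
  moreover have "inner ?v (p k) \<le> inner ?v (p j)"
    using strict[of k] by (cases "k = j") auto
  moreover have "inner ?v s \<le> inner ?v (p j)"
    using strict assms(2) by (rule strict_max_vertex)
  ultimately have "inner ?v s = inner ?v (p j)" by (simp add: field_simps)
  with strict assms(2) show ?thesis by (rule strict_max_vertex)
qed

text \<open>
  Along the edge from \<open>p i\<close> to \<open>p j\<close>, the point \<open>s\<close> lies at most as far as \<open>p j\<close> and \<open>t\<close> at least as
  far as \<open>p i\<close>, while \<open>s - t = p j - p i\<close>; so \<open>s\<close> is extremal.
\<close>

lemma sg_maps_meet:
  assumes eq: "equilateral_triangle p" and "i \<noteq> j"
    and st: "s \<in> sierpinski_gasket p" "t \<in> sierpinski_gasket p"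
    and meet: "sg_map p i s = sg_map p j t"
  shows "s = p j"
proof -
  let ?v = "p j - p i"
  note strict = edge_functional_strict_max[OF eq \<open>i \<noteq> j\<close>]
  have "s + p i = t + p j"
    using meet by (simp add: sg_map_def)
  then have "inner ?v s + inner ?v (p i) = inner ?v t + inner ?v (p j)"
    by (metis inner_add_right)
  moreover have "inner ?v s \<le> inner ?v (p j)"
    using strict st(1) by (rule strict_max_vertex)
  moreover have "inner (p i - p j) t \<le> inner (p i - p j) (p i)"
    using edge_functional_strict_max[OF eq \<open>i \<noteq> j\<close>[symmetric]] st(2) by (rule strict_max_vertex)
  then have "inner ?v t \<ge> inner ?v (p i)"
    by (simp add: inner_diff_left)
  ultimately have "inner ?v s = inner ?v (p j)" by linarith
  with strict st(1) show ?thesis by (rule strict_max_vertex)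
qed

lemma sg_word_map_in_gasket:
  "t \<in> sierpinski_gasket p \<Longrightarrow> sg_word_map p \<omega> t \<in> sierpinski_gasket p"
  by (induction \<omega>)
    (auto intro: sg_attractor_closed_under_map[OF sg_attractor_sierpinski_gasket])

lemma continuous_on_sg_word_map: "continuous_on A (sg_word_map p \<omega>)"
proof (induction \<omega>)
  case (Cons i \<omega>)
  then show ?case
    unfolding sg_word_map.simps by (rule continuous_on_compose) (rule continuous_on_sg_map)
qed (simp add: id_def)

lemma inj_on_sg_word_map: "inj_on (sg_word_map p \<omega>) A"
  by (induction \<omega>) (auto simp: inj_on_def sg_map_eq_iff)

lemma gasket_covered_by_cells:
  "x \<in> sierpinski_gasket p \<Longrightarrow> \<exists>\<omega>\<in>sg_words N. x \<in> sg_word_map p \<omega> ` sierpinski_gasket p"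
proof (induction N arbitrary: x)
  case 0
  then show ?case by (simp add: sg_words_def)
next
  case (Suc N)
  obtain i y where y: "y \<in> sierpinski_gasket p" "x = sg_map p i y"
    using sg_attractor_cases[OF sg_attractor_sierpinski_gasket Suc.prems] by blast
  obtain \<omega> t where "\<omega> \<in> sg_words N" "t \<in> sierpinski_gasket p" "y = sg_word_map p \<omega> t"
    using Suc.IH[OF y(1)] by blast
  then show ?case
    using y by (intro bexI[of _ "i # \<omega>"]) (auto simp: sg_words_def)
qed

lemma finite_sg_words: "finite (sg_words N)"
  using finite_lists_length_eq[of "UNIV :: 3 set" N] by (simp add: sg_words_def)

lemma sg_word_map_eq_vertex:
  assumes "equilateral_triangle p" "t \<in> sierpinski_gasket p" "sg_word_map p \<omega> t = p j"
  shows "t = p j"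
  using assms(3)
proof (induction \<omega>)
  case (Cons i \<omega>)
  then have "sg_map p i (sg_word_map p \<omega> t) = p j" by simp
  then have "sg_word_map p \<omega> t = p j"
    by (rule sg_map_eq_vertex[OF assms(1) sg_word_map_in_gasket[OF assms(2)]])
  then show ?case by (rule Cons.IH)
qed simp

text \<open>
  Cancel the common prefix of the two words. At the first letters that differ, the
  remaining parts both map to vertices, and only vertices are mapped to vertices.
\<close>

lemma cells_meet_at_vertices:
  assumes "equilateral_triangle p" "length \<omega> = length \<tau>" "\<omega> \<noteq> \<tau>"
    and "s \<in> sierpinski_gasket p" "t \<in> sierpinski_gasket p"
    and "sg_word_map p \<omega> s = sg_word_map p \<tau> t"
  shows "s \<in> range p"
  using assms(2,3,6)
proof (induction \<omega> \<tau> rule: list_induct2)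
  case (Cons i \<omega> j \<tau>)
  have eq: "sg_map p i (sg_word_map p \<omega> s) = sg_map p j (sg_word_map p \<tau> t)"
    using Cons.prems by simp
  show ?case
  proof (cases "i = j")
    case True
    then show ?thesis
      using Cons.IH Cons.prems eq by (auto simp: sg_map_eq_iff)
  next
    case False
    then have "sg_word_map p \<omega> s = p j"
      by (rule sg_maps_meet[OF assms(1) _ sg_word_map_in_gasket sg_word_map_in_gasket eq])
        (fact assms(4,5))+
    then have "s = p j"
      by (rule sg_word_map_eq_vertex[OF assms(1,4)])
    then show ?thesis by simp
  qed
qed simp

section \<open>A self-referential equation on a self-similar compact set\<close>

text \<open>
  A point may lie in several cells, and one of them is chosen here. The choice is immaterial
  for functions that vanish on the set where cells overlap.
\<close>

definition cell_transfer ::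
  "'i set \<Rightarrow> 'a set \<Rightarrow> ('i \<Rightarrow> 'a \<Rightarrow> 'a) \<Rightarrow> ('i \<Rightarrow> 'a \<Rightarrow> real) \<Rightarrow> ('a \<Rightarrow> real) \<Rightarrow> 'a \<Rightarrow> real" where
  "cell_transfer W K L \<alpha> g x =
     (let w = SOME w. w \<in> W \<and> x \<in> L w ` K; t = inv_into K (L w) x in \<alpha> w t * g t)"

text \<open>
  The set \<open>V\<close> plays the role of the vertices. It contains all preimages of overlap points, and by
  the second closure condition all preimages of its own points.
\<close>

locale cell_system =
  fixes W :: "'i set" and K V :: "'a::metric_space set" and L :: "'i \<Rightarrow> 'a \<Rightarrow> 'a"
    and \<alpha> :: "'i \<Rightarrow> 'a \<Rightarrow> real" and c :: real
  assumes finite_W: "finite W" and compact_K: "compact K"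
    and map_in: "\<And>w t. w \<in> W \<Longrightarrow> t \<in> K \<Longrightarrow> L w t \<in> K"
    and continuous_map: "\<And>w. w \<in> W \<Longrightarrow> continuous_on K (L w)"
    and inj_map: "\<And>w. w \<in> W \<Longrightarrow> inj_on (L w) K"
    and cover: "\<And>x. x \<in> K \<Longrightarrow> \<exists>w\<in>W. x \<in> L w ` K"
    and overlap: "\<And>v w s t. \<lbrakk>v \<in> W; w \<in> W; v \<noteq> w; s \<in> K; t \<in> K; L v s = L w t\<rbrakk> \<Longrightarrow> s \<in> V"
    and preimage_V: "\<And>w t. \<lbrakk>w \<in> W; t \<in> K; L w t \<in> V\<rbrakk> \<Longrightarrow> t \<in> V"
    and continuous_scale: "\<And>w. w \<in> W \<Longrightarrow> continuous_on K (\<alpha> w)"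
    and scale_bound: "\<And>w t. w \<in> W \<Longrightarrow> t \<in> K \<Longrightarrow> \<bar>\<alpha> w t\<bar> \<le> c"
    and c_bounds: "0 \<le> c" "c < 1"
begin

abbreviation "S \<equiv> cell_transfer W K L \<alpha>"

lemma cell_transfer_map:
  assumes "\<And>x. x \<in> K \<inter> V \<Longrightarrow> g x = 0" and w: "w \<in> W" and t: "t \<in> K"
  shows "S g (L w t) = \<alpha> w t * g t"
proof -
  define v where "v = (SOME v. v \<in> W \<and> L w t \<in> L v ` K)"
  have "v \<in> W \<and> L w t \<in> L v ` K"
    unfolding v_def by (rule someI[of _ w]) (use w t in auto)
  then obtain s where v: "v \<in> W" and s: "s \<in> K" "L w t = L v s"
    by blast
  have inv: "inv_into K (L v) (L w t) = s"
    using inv_into_f_f[OF inj_map[OF v] s(1)] s(2) by simp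
  have S: "S g (L w t) = \<alpha> v s * g s"
    by (simp add: cell_transfer_def v_def[symmetric] inv)
  show ?thesis
  proof (cases "v = w")
    case True
    then have "s = t"
      using inj_onD[OF inj_map[OF w] _ t s(1)] s(2) by simp
    with S True show ?thesis by simp
  next
    case False
    then have "s \<in> V" "t \<in> V"
      using overlap[of v w s t] overlap[of w v t s] v w s t by auto
    with S assms(1) s t show ?thesis by simp
  qed
qed

lemma cell_transfer_zero_on_V:
  assumes g: "\<And>x. x \<in> K \<inter> V \<Longrightarrow> g x = 0" and x: "x \<in> K \<inter> V"
  shows "S g x = 0"
proof -
  obtain w t where w: "w \<in> W" "t \<in> K" "x = L w t"
    using cover x by blast
  then have "t \<in> V" using preimage_V x by blast
  then show ?thesis
    using cell_transfer_map[OF g w(1,2)] g w by simp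
qed

text \<open>
  On each of the finitely many closed cells, \<open>S g\<close> is a continuous function of the preimage, which
  by compactness depends continuously on the point.
\<close>

lemma continuous_on_cell_transfer:
  assumes "\<And>x. x \<in> K \<inter> V \<Longrightarrow> g x = 0" and g: "continuous_on K g"
  shows "continuous_on K (S g)"
proof -
  have "continuous_on (L w ` K) (S g)" if w: "w \<in> W" for w
  proof -
    let ?r = "inv_into K (L w)"
    have S_map: "S g (L w t) = \<alpha> w t * g t" if "t \<in> K" for t
      using assms(1) w that by (rule cell_transfer_map)
    have r: "continuous_on (L w ` K) ?r"
      by (rule continuous_on_inv[OF continuous_map[OF w] compact_K])
        (simp add: inv_into_f_f[OF inj_map[OF w]])
    have im: "?r ` (L w ` K) \<subseteq> K"
      by (auto intro: inv_into_into)
    have "continuous_on (L w ` K) (\<lambda>x. \<alpha> w (?r x) * g (?r x))"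
      by (intro continuous_intros continuous_on_compose2[OF continuous_scale[OF w] r im]
            continuous_on_compose2[OF g r im])
    then show ?thesis
      by (rule continuous_on_eq)
        (auto simp: S_map inv_into_f_f[OF inj_map[OF w]])
  qed
  moreover have "closed (L w ` K)" if "w \<in> W" for w
    by (rule compact_imp_closed[OF compact_continuous_image[OF continuous_map[OF that] compact_K]])
  ultimately have "continuous_on (\<Union>w\<in>W. L w ` K) (S g)"
    by (intro continuous_on_closed_Union finite_W) auto
  moreover have "(\<Union>w\<in>W. L w ` K) = K"
    using cover map_in by blast
  ultimately show ?thesis by simp
qed

lemma cell_transfer_bound:
  assumes "\<And>x. x \<in> K \<inter> V \<Longrightarrow> g x = 0" and g: "\<And>x. x \<in> K \<Longrightarrow> \<bar>g x\<bar> \<le> M"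
    and x: "x \<in> K"
  shows "\<bar>S g x\<bar> \<le> c * M"
proof -
  obtain w t where w: "w \<in> W" "t \<in> K" "x = L w t"
    using cover x by blast
  then have "\<bar>S g x\<bar> = \<bar>\<alpha> w t\<bar> * \<bar>g t\<bar>"
    using cell_transfer_map[OF assms(1) w(1,2)] by (simp add: abs_mult)
  also have "\<dots> \<le> c * M"
    by (intro mult_mono scale_bound g w c_bounds) auto
  finally show ?thesis .
qed

text \<open>
  The solution is the Neumann series of \<open>S\<close> applied to \<open>q\<close>; it is dominated by a geometric
  series with ratio \<open>c\<close>, so the limit is continuous and \<open>S\<close> may be applied termwise.
\<close>

lemma self_referential_solution_exists:
  assumes q: "continuous_on K q" and zero: "\<And>x. x \<in> K \<inter> V \<Longrightarrow> q x = 0"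
  shows "\<exists>u. continuous_on K u \<and> (\<forall>w\<in>W. \<forall>t\<in>K. u (L w t) = q (L w t) + \<alpha> w t * u t)"
proof -
  define s where "s n = (S ^^ n) q" for n
  have s_Suc: "s (Suc n) = S (s n)" for n
    by (simp add: s_def)
  have "bounded (q ` K)"
    by (rule compact_imp_bounded[OF compact_continuous_image[OF q compact_K]])
  then obtain M where M: "\<And>x. x \<in> K \<Longrightarrow> \<bar>q x\<bar> \<le> M"
    unfolding bounded_iff by auto
  have s: "continuous_on K (s n) \<and> (\<forall>x\<in>K \<inter> V. s n x = 0) \<and> (\<forall>x\<in>K. \<bar>s n x\<bar> \<le> M * c ^ n)" for n
  proof (induction n)
    case 0
    then show ?case using q zero M by (simp add: s_def)
  next
    case (Suc n)
    then have z: "\<And>x. x \<in> K \<inter> V \<Longrightarrow> s n x = 0" and bd: "\<And>x. x \<in> K \<Longrightarrow> \<bar>s n x\<bar> \<le> M * c ^ n"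
      and cont: "continuous_on K (s n)"
      by blast+
    have "\<bar>S (s n) x\<bar> \<le> M * c ^ Suc n" if "x \<in> K" for x
      using cell_transfer_bound[OF z bd that] by (simp add: mult_ac)
    then show ?case
      unfolding s_Suc
      using continuous_on_cell_transfer[of "s n"] cell_transfer_zero_on_V[of "s n"] z cont by blast
  qed
  have geo: "summable (\<lambda>n. M * c ^ n)"
    using c_bounds by (intro summable_mult summable_geometric) simp
  have summable: "summable (\<lambda>n. s n x)" if "x \<in> K" for x
    by (rule summable_comparison_test'[OF geo, of 0]) (use s that in auto)
  define u where "u x = (\<Sum>n. s n x)" for x
  have "uniform_limit K (\<lambda>n x. \<Sum>i<n. s i x) u sequentially"
    unfolding u_def by (rule Weierstrass_m_test[OF _ geo]) (use s in auto)
  moreover have "\<forall>\<^sub>F n in sequentially. continuous_on K (\<lambda>x. \<Sum>i<n. s i x)"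
    using s by (intro always_eventually allI continuous_on_sum) blast
  ultimately have "continuous_on K u"
    by (intro uniform_limit_theorem) auto
  moreover have "u (L w t) = q (L w t) + \<alpha> w t * u t" if w: "w \<in> W" and t: "t \<in> K" for w t
  proof -
    have "s (Suc n) (L w t) = \<alpha> w t * s n t" for n
      unfolding s_Suc by (rule cell_transfer_map[OF _ w t]) (use s in blast)
    then have "(\<Sum>n. s (Suc n) (L w t)) = \<alpha> w t * u t"
      unfolding u_def by (simp add: suminf_mult[OF summable[OF t]])
    moreover have "u (L w t) = (\<Sum>n. s (Suc n) (L w t)) + s 0 (L w t)"
      unfolding u_def using suminf_split_head[OF summable[OF map_in[OF w t]]] by simp
    ultimately show ?thesis by (simp add: s_def)
  qed
  ultimately show ?thesis by blast
qed

text \<open>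
  The modulus of the scale is used so that the hypothesis holds for the absolute value of the
  difference of two solutions, whatever the signs of the \<open>\<alpha> w\<close>.
\<close>

lemma cellwise_contracted_nonpos:
  assumes "continuous_on K d"
    and contr: "\<And>w t. w \<in> W \<Longrightarrow> t \<in> K \<Longrightarrow> d (L w t) \<le> \<bar>\<alpha> w t\<bar> * d t"
    and "x \<in> K"
  shows "d x \<le> 0"
proof (rule contracted_values_nonpos[OF compact_K assms(1) _ \<open>x \<in> K\<close>])
  fix x assume "x \<in> K"
  then obtain w t where w: "w \<in> W" "t \<in> K" "x = L w t"
    using cover by blast
  then have "d x \<le> \<bar>\<alpha> w t\<bar> * d t" "\<bar>\<alpha> w t\<bar> < 1"
    using contr scale_bound[of w t] c_bounds by auto
  then show "\<exists>y\<in>K. \<exists>a. 0 \<le> a \<and> a < 1 \<and> d x \<le> a * d y"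
    using w(2) by (intro bexI[of _ t] exI[of _ "\<bar>\<alpha> w t\<bar>"]) auto
qed

end

section \<open>The fractal function\<close>

lemma abs_le_sup_norm_on:
  assumes "compact K" "continuous_on K g" "t \<in> K"
  shows "\<bar>g t\<bar> \<le> sup_norm_on K g"
proof -
  have "compact ((\<lambda>t. \<bar>g t\<bar>) ` K)"
    using assms by (intro compact_continuous_image continuous_intros)
  then have "bdd_above ((\<lambda>t. \<bar>g t\<bar>) ` K)"
    by (intro bounded_imp_bdd_above compact_imp_bounded)
  then show ?thesis
    unfolding sup_norm_on_def by (rule cSUP_upper[OF assms(3)])
qed

lemma gasket_cell_system:
  fixes p :: "3 \<Rightarrow> real^2"
  defines "K \<equiv> sierpinski_gasket p"
  assumes tri: "equilateral_triangle p"
    and cont: "\<And>\<omega>. \<omega> \<in> sg_words N \<Longrightarrow> continuous_on K (\<alpha> \<omega>)"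
    and norm: "\<And>\<omega>. \<omega> \<in> sg_words N \<Longrightarrow> sup_norm_on K (\<alpha> \<omega>) < 1"
  shows "\<exists>c. cell_system (sg_words N) K (range p) (sg_word_map p) \<alpha> c"
proof -
  \<comment> \<open>Including 0 makes the common bound nonnegative, as the ratio of the geometric series must be.\<close>
  define A where "A = insert 0 ((\<lambda>\<omega>. sup_norm_on K (\<alpha> \<omega>)) ` sg_words N)"
  have fin: "finite A"
    by (simp add: A_def finite_sg_words)
  have compact: "compact K"
    unfolding K_def by (rule compact_sierpinski_gasket)
  have "cell_system (sg_words N) K (range p) (sg_word_map p) \<alpha> (Max A)"
  proof
    fix \<omega> \<tau> s t
    assume "\<omega> \<in> sg_words N" "\<tau> \<in> sg_words N" "\<omega> \<noteq> \<tau>" "s \<in> K" "t \<in> K"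
      "sg_word_map p \<omega> s = sg_word_map p \<tau> t"
    then show "s \<in> range p"
      unfolding K_def sg_words_def using cells_meet_at_vertices[OF tri, of \<omega> \<tau> s t] by auto
  next
    fix \<omega> t
    assume "t \<in> K" "sg_word_map p \<omega> t \<in> range p"
    then show "t \<in> range p"
      unfolding K_def using sg_word_map_eq_vertex[OF tri] by blast
  next
    fix \<omega> t
    assume \<omega>: "\<omega> \<in> sg_words N" and t: "t \<in> K"
    have "\<bar>\<alpha> \<omega> t\<bar> \<le> sup_norm_on K (\<alpha> \<omega>)"
      by (rule abs_le_sup_norm_on[OF compact cont[OF \<omega>] t])
    also have "\<dots> \<le> Max A"
      by (rule Max_ge[OF fin]) (simp add: A_def \<omega>)
    finally show "\<bar>\<alpha> \<omega> t\<bar> \<le> Max A" .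
  next
    show "0 \<le> Max A"
      by (rule Max_ge[OF fin]) (simp add: A_def)
    show "Max A < 1"
      using fin norm by (subst Max_less_iff) (auto simp: A_def)
  qed (auto simp: K_def finite_sg_words compact_sierpinski_gasket continuous_on_sg_word_map
      inj_on_sg_word_map gasket_covered_by_cells cont[unfolded K_def]
      intro: sg_word_map_in_gasket)
  then show ?thesis by blast
qed

text \<open>
  Agreement of \<open>b\<close> and \<open>f\<close> at the vertices makes the Neumann series for \<open>f - b\<close> available, which
  gives existence; the maximum principle gives uniqueness. Hence the definite description
  denotes a function with the defining properties.
\<close>

lemma alpha_fractal_properties:
  fixes p :: "3 \<Rightarrow> real^2"
  defines "K \<equiv> sierpinski_gasket p"
  assumes sys: "cell_system (sg_words N) K (range p) (sg_word_map p) \<alpha> c"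
    and f: "continuous_on K f" and b: "continuous_on K b"
    and boundary: "\<And>j. b (p j) = f (p j)"
  defines "F \<equiv> alpha_fractal p N \<alpha> b f"
  shows "continuous_on K F"
    and "\<And>\<omega> t. \<omega> \<in> sg_words N \<Longrightarrow> t \<in> K \<Longrightarrow>
      F (sg_word_map p \<omega> t) = f (sg_word_map p \<omega> t) + \<alpha> \<omega> t * (F t - b t)"
proof -
  interpret cell_system "sg_words N" K "range p" "sg_word_map p" \<alpha> c
    by (rule sys)
  define P where "P g \<longleftrightarrow> g \<in> extensional K \<and> continuous_on K g \<and>
    (\<forall>\<omega>\<in>sg_words N. \<forall>t\<in>K.
      g (sg_word_map p \<omega> t) = f (sg_word_map p \<omega> t) + \<alpha> \<omega> t * (g t - b t))" for g
  have "\<exists>g. P g"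
  proof -
    have "continuous_on K (\<lambda>x. f x - b x)"
      by (intro continuous_intros f b)
    moreover have "f x - b x = 0" if "x \<in> K \<inter> range p" for x
      using that boundary by auto
    ultimately obtain u where u: "continuous_on K u" and
      eq: "\<And>\<omega> t. \<omega> \<in> sg_words N \<Longrightarrow> t \<in> K \<Longrightarrow> u (sg_word_map p \<omega> t) =
        f (sg_word_map p \<omega> t) - b (sg_word_map p \<omega> t) + \<alpha> \<omega> t * u t"
      using self_referential_solution_exists[of "\<lambda>x. f x - b x"] by blast
    define g where "g = restrict (\<lambda>x. b x + u x) K"
    have "continuous_on K (\<lambda>x. b x + u x)"
      by (intro continuous_intros b u)
    then have "continuous_on K g"
      by (rule continuous_on_eq) (simp add: g_def)
    then have "P g"
      unfolding P_def by (simp add: g_def map_in eq)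
    then show ?thesis by blast
  qed
  moreover have "g = g'" if g: "P g" and g': "P g'" for g g'
  proof (rule extensionalityI[of _ K])
    show "g \<in> extensional K" "g' \<in> extensional K"
      using g g' by (simp_all add: P_def)
    fix x assume x: "x \<in> K"
    have "\<bar>g x - g' x\<bar> \<le> 0"
    proof (rule cellwise_contracted_nonpos[OF _ _ x, where d = "\<lambda>x. \<bar>g x - g' x\<bar>"])
      show "continuous_on K (\<lambda>x. \<bar>g x - g' x\<bar>)"
        using g g' unfolding P_def by (intro continuous_intros) auto
    next
      fix \<omega> t assume "\<omega> \<in> sg_words N" "t \<in> K"
      then have "g (sg_word_map p \<omega> t) = f (sg_word_map p \<omega> t) + \<alpha> \<omega> t * (g t - b t)"
        "g' (sg_word_map p \<omega> t) = f (sg_word_map p \<omega> t) + \<alpha> \<omega> t * (g' t - b t)"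
        using g g' unfolding P_def by blast+
      then have "g (sg_word_map p \<omega> t) - g' (sg_word_map p \<omega> t) = \<alpha> \<omega> t * (g t - g' t)"
        by (simp add: algebra_simps)
      then show "\<bar>g (sg_word_map p \<omega> t) - g' (sg_word_map p \<omega> t)\<bar> \<le> \<bar>\<alpha> \<omega> t\<bar> * \<bar>g t - g' t\<bar>"
        by (simp add: abs_mult)
    qed
    then show "g x = g' x" by simp
  qed
  ultimately have "\<exists>!g. P g" by blast
  then have "P (THE g. P g)" by (rule theI')
  moreover have "F = (THE g. P g)"
    unfolding F_def alpha_fractal_def P_def K_def ..
  ultimately have "P F" by simp
  then show "continuous_on K F"
    and "\<And>\<omega> t. \<omega> \<in> sg_words N \<Longrightarrow> t \<in> K \<Longrightarrow>
      F (sg_word_map p \<omega> t) = f (sg_word_map p \<omega> t) + \<alpha> \<omega> t * (F t - b t)"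
    unfolding P_def by blast+
qed

theorem theorem4p3:
  fixes p :: "3 \<Rightarrow> real^2"
    and N :: nat
    and f b :: "real^2 \<Rightarrow> real"
    and \<alpha> :: "3 list \<Rightarrow> real^2 \<Rightarrow> real"
  assumes "equilateral_triangle p"
    and "continuous_on (sierpinski_gasket p) f"
    and "N \<ge> 1"
    and "\<And>\<omega>. \<omega> \<in> sg_words N \<Longrightarrow> continuous_on (sierpinski_gasket p) (\<alpha> \<omega>)"
    and "\<And>\<omega>. \<omega> \<in> sg_words N \<Longrightarrow> sup_norm_on (sierpinski_gasket p) (\<alpha> \<omega>) < 1"
    and "continuous_on (sierpinski_gasket p) b"
    and "\<And>j. b (p j) = f (p j)"
    and "\<And>\<omega> t. \<omega> \<in> sg_words N \<Longrightarrow> t \<in> sierpinski_gasket p \<Longrightarrow> \<alpha> \<omega> t \<ge> 0"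
    and "\<And>t. t \<in> sierpinski_gasket p \<Longrightarrow> b t \<ge> f t"
  shows "\<forall>t\<in>sierpinski_gasket p. alpha_fractal p N \<alpha> b f t \<le> f t"
proof
  fix x assume x: "x \<in> sierpinski_gasket p"
  let ?K = "sierpinski_gasket p" and ?F = "alpha_fractal p N \<alpha> b f"
  obtain c where sys: "cell_system (sg_words N) ?K (range p) (sg_word_map p) \<alpha> c"
    using gasket_cell_system[of p N \<alpha>, OF assms(1,4,5)] by blast
  note F = alpha_fractal_properties[OF sys assms(2,6,7)]
  have "?F x - f x \<le> 0"
  proof (rule cell_system.cellwise_contracted_nonpos[OF sys _ _ x, where d = "\<lambda>x. ?F x - f x"])
    show "continuous_on ?K (\<lambda>x. ?F x - f x)"
      by (intro continuous_intros F(1) assms(2))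
  next
    fix \<omega> t assume \<omega>: "\<omega> \<in> sg_words N" and t: "t \<in> ?K"
    have "?F (sg_word_map p \<omega> t) - f (sg_word_map p \<omega> t) = \<alpha> \<omega> t * (?F t - b t)"
      by (simp add: F(2)[OF \<omega> t])
    also have "\<dots> \<le> \<alpha> \<omega> t * (?F t - f t)"
      using assms(8)[OF \<omega> t] assms(9)[OF t] by (intro mult_left_mono) auto
    finally show "?F (sg_word_map p \<omega> t) - f (sg_word_map p \<omega> t) \<le> \<bar>\<alpha> \<omega> t\<bar> * (?F t - f t)"
      using assms(8)[OF \<omega> t] by simp
  qed
  then show "?F x \<le> f x" by simp
qed

end
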